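(* Let $(A,\mathfrak{m})$ be a local ring with infinite residue field $K=A/\mathfrak{m}$ and let $\mathfrak{a}\subseteq A$ be a finitely generated ideal with $\mathfrak{a}\neq 0$. Let $S$ be a set of ideals of $A$ not containing $\mathfrak{a}$ (that is, $\mathfrak{a}\not\subseteq\mathfrak{b}$ for every $\mathfrak{b}\in S$), and let $T$ be a set of ideals of $\operatorname{Gr}(\mathfrak{a})$ not containing $\operatorname{Gr}(\mathfrak{a})_+$ (that is, $\operatorname{Gr}(\mathfrak{a})_+\not\subseteq\mathfrak{c}$ for every $\mathfrak{c}\in T$). Assume that $S\cup T$ has cardinality strictly less than the cardinality of $K$. Then there is an element $x\in\mathfrak{a}\setminus\bigl(\mathfrak{m}\mathfrak{a}\cup\bigcup_{\mathfrak{b}\in S}\mathfrak{b}\bigr)$ such that $x+\mathfrak{a}^2\in\operatorname{Gr}(\mathfrak{a})_1\setminus\bigcup_{\mathfrak{c}\in T}\mathfrak{c}$.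
   Context: Rings are commutative with unit. Local rings are not assumed to be Noetherian here. For an ideal $\mathfrak{a}$ of a ring $A$, $\operatorname{Gr}(\mathfrak{a})=\bigoplus_{n\ge 0}\mathfrak{a}^n/\mathfrak{a}^{n+1}$ denotes the graded ring associated with $\mathfrak{a}$. Its degree one component is $\operatorname{Gr}(\mathfrak{a})_1=\mathfrak{a}/\mathfrak{a}^2$, and its irrelevant ideal is $\operatorname{Gr}(\mathfrak{a})_+=\bigoplus_{n\ge 1}\mathfrak{a}^n/\mathfrak{a}^{n+1}$. The ideals in $T$ are not assumed to be homogeneous. *)

theory Defs
  imports "HOL-Algebra.Ideal_Product" "HOL-Algebra.QuotRing" "HOL-Algebra.Subrings"
    "HOL-Algebra.UnivPoly"
begin

locale local_ring = cring R + maximalideal M R for R (structure) and M +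
  assumes unique_maximalideal: "maximalideal J R \<Longrightarrow> J = M"

definition finitely_generated_ideal :: "('a, 'b) ring_scheme \<Rightarrow> 'a set \<Rightarrow> bool" where
  "finitely_generated_ideal R I \<longleftrightarrow>
     (\<exists>F. finite F \<and> F \<subseteq> carrier R \<and> I = genideal R F)"

text \<open>Powers are taken in the monoid of ideals, so that the power with exponent \<open>0\<close>
  is \<open>carrier R\<close>.\<close>

definition ideal_pow :: "('a, 'b) ring_scheme \<Rightarrow> 'a set \<Rightarrow> nat \<Rightarrow> 'a set" where
  "ideal_pow R I n = I [^]\<^bsub>ideals_set R\<^esub> n"


text \<open>The quotient \<open>I\<^sup>n / I\<^sup>n\<^sup>+\<^sup>1\<close> is represented by those cosets in
  \<open>R / I\<^sup>n\<^sup>+\<^sup>1\<close> that have a representative in \<open>I\<^sup>n\<close>.\<close>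

definition Gr_comp :: "('a, 'b) ring_scheme \<Rightarrow> 'a set \<Rightarrow> nat \<Rightarrow> 'a set set" where
  "Gr_comp R I n = (\<lambda>x. ideal_pow R I (Suc n) +>\<^bsub>R\<^esub> x) ` ideal_pow R I n"

text \<open>The inclusion of the component of degree \<open>n\<close> into the direct sum; note that
  \<open>ideal_pow R I (Suc k)\<close> is the zero of the component of degree \<open>k\<close>.\<close>

definition Gr_in :: "('a, 'b) ring_scheme \<Rightarrow> 'a set \<Rightarrow> nat \<Rightarrow> 'a set \<Rightarrow> (nat \<Rightarrow> 'a set)" where
  "Gr_in R I n c = (\<lambda>k. if k = n then c else ideal_pow R I (Suc k))"

text \<open>Elements of the direct sum are families of cosets with finite support.
  The product of cosets \<open>x + I\<^sup>i\<^sup>+\<^sup>1\<close> and \<open>y + I\<^sup>j\<^sup>+\<^sup>1\<close>, with \<open>x\<close> in \<open>I\<^sup>i\<close>,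
  \<open>y\<close> in \<open>I\<^sup>j\<close> and \<open>i + j = n\<close>, is the coset \<open>xy + I\<^sup>n\<^sup>+\<^sup>1\<close>.\<close>

definition Gr :: "('a, 'b) ring_scheme \<Rightarrow> 'a set \<Rightarrow> (nat \<Rightarrow> 'a set) ring" where
  "Gr R I = \<lparr>
     carrier = {f. (\<forall>n. f n \<in> Gr_comp R I n) \<and> finite {n. f n \<noteq> ideal_pow R I (Suc n)}},
     mult = (\<lambda>f g n. \<Oplus>\<^bsub>R Quot ideal_pow R I (Suc n)\<^esub> i \<in> {..n}.
               rcoset_mult R (ideal_pow R I (Suc n)) (f i) (g (n - i))),
     one = Gr_in R I 0 (ideal_pow R I 1 +>\<^bsub>R\<^esub> \<one>\<^bsub>R\<^esub>),
     zero = (\<lambda>n. ideal_pow R I (Suc n)),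
     add = (\<lambda>f g n. f n <+>\<^bsub>R\<^esub> g n)\<rparr>"

definition Gr_deg :: "('a, 'b) ring_scheme \<Rightarrow> 'a set \<Rightarrow> nat \<Rightarrow> (nat \<Rightarrow> 'a set) set" where
  "Gr_deg R I n = Gr_in R I n ` Gr_comp R I n"

definition Gr_irrelevant :: "('a, 'b) ring_scheme \<Rightarrow> 'a set \<Rightarrow> (nat \<Rightarrow> 'a set) set" where
  "Gr_irrelevant R I = {f \<in> carrier (Gr R I). f 0 = \<zero>\<^bsub>Gr R I\<^esub> 0}"


context cring
begin

lemma ideal_pow_ideal:
  assumes "ideal I R"
  shows "ideal (ideal_pow R I n) R"
proof -
  interpret M: comm_monoid "ideals_set R" by (rule ideals_set_is_comm_monoid)
  have "I \<in> carrier (ideals_set R)" using assms by (simp add: ideals_set_def)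
  from M.nat_pow_closed[OF this] show ?thesis
    by (simp add: ideals_set_def ideal_pow_def)
qed

lemma ideal_pow_0: "ideal_pow R I 0 = carrier R"
  by (simp add: ideal_pow_def nat_pow_def ideals_set_def)

lemma ideal_pow_Suc: "ideal_pow R I (Suc n) = ideal_prod R (ideal_pow R I n) I"
  by (simp add: ideal_pow_def nat_pow_def ideals_set_def)

lemma ideal_pow_1: "ideal I R \<Longrightarrow> ideal_pow R I 1 = I"
  using ideal_prod_commute[of I "carrier R"] ideal_prod_one[of I] oneideal
  by (simp add: ideal_pow_Suc ideal_pow_0)

lemma ideal_pow_Suc_subset: "ideal I R \<Longrightarrow> ideal_pow R I (Suc n) \<subseteq> ideal_pow R I n"
  using ideal_prod_inter[OF ideal_pow_ideal] by (auto simp: ideal_pow_Suc)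

lemma ideal_pow_mult:
  assumes "ideal I R" "x \<in> ideal_pow R I i" "y \<in> ideal_pow R I j"
  shows "x \<otimes> y \<in> ideal_pow R I (i + j)"
proof -
  interpret M: comm_monoid "ideals_set R" by (rule ideals_set_is_comm_monoid)
  have "I \<in> carrier (ideals_set R)" using assms by (simp add: ideals_set_def)
  from M.nat_pow_mult[OF this, of i j]
  have "ideal_prod R (ideal_pow R I i) (ideal_pow R I j) = ideal_pow R I (i + j)"
    by (simp add: ideals_set_def ideal_pow_def)
  with ideal_prod.prod[OF assms(2,3), of R] show ?thesis by simp
qed

lemma rcoset_mult_Gr_comp:
  assumes I: "ideal I R" and x: "x \<in> ideal_pow R I i" and y: "y \<in> ideal_pow R I j"
  shows "rcoset_mult R (ideal_pow R I (Suc (i + j)))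
           (ideal_pow R I (Suc i) +> x) (ideal_pow R I (Suc j) +> y)
         = ideal_pow R I (Suc (i + j)) +> (x \<otimes> y)"
proof -
  let ?J = "\<lambda>n. ideal_pow R I n"
  interpret Jij: ideal "?J (Suc (i + j))" R by (rule ideal_pow_ideal[OF I])
  interpret Ji: ideal "?J (Suc i)" R by (rule ideal_pow_ideal[OF I])
  interpret Jj: ideal "?J (Suc j)" R by (rule ideal_pow_ideal[OF I])
  have xc: "x \<in> carrier R" and yc: "y \<in> carrier R"
    using x y ideal.Icarr[OF ideal_pow_ideal[OF I]] by auto
  have *: "?J (Suc (i + j)) +> (u \<otimes> v) = ?J (Suc (i + j)) +> (x \<otimes> y)"
    if u: "u \<in> ?J (Suc i) +> x" and v: "v \<in> ?J (Suc j) +> y" for u v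
  proof -
    from u obtain r where r: "r \<in> ?J (Suc i)" and u: "u = r \<oplus> x"
      by (auto simp: a_r_coset_def r_coset_def)
    from v obtain s where s: "s \<in> ?J (Suc j)" and v: "v = s \<oplus> y"
      by (auto simp: a_r_coset_def r_coset_def)
    have rc: "r \<in> carrier R" and sc: "s \<in> carrier R" using r s by auto
    have sj: "s \<in> ?J j" using s ideal_pow_Suc_subset[OF I] by blast
    have 1: "r \<otimes> s \<in> ?J (Suc (i + j))" using ideal_pow_mult[OF I r sj] by simp
    have 2: "r \<otimes> y \<in> ?J (Suc (i + j))" using ideal_pow_mult[OF I r y] by simp
    have 3: "x \<otimes> s \<in> ?J (Suc (i + j))" using ideal_pow_mult[OF I x s] by simp
    have "u \<otimes> v = (r \<otimes> s \<oplus> r \<otimes> y \<oplus> x \<otimes> s) \<oplus> x \<otimes> y"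
      unfolding u v using rc sc xc yc by algebra
    moreover have "r \<otimes> s \<oplus> r \<otimes> y \<oplus> x \<otimes> s \<in> ?J (Suc (i + j))" using 1 2 3 by simp
    ultimately have "u \<otimes> v \<in> ?J (Suc (i + j)) +> (x \<otimes> y)"
      by (auto simp: a_r_coset_def r_coset_def)
    then show ?thesis
      using Jij.a_repr_independence' xc yc by simp
  qed
  have "x \<in> ?J (Suc i) +> x" "y \<in> ?J (Suc j) +> y"
    using Ji.a_rcos_self Jj.a_rcos_self xc yc by auto
  then show ?thesis
    unfolding rcoset_mult_def using * by blast
qed

text \<open>The associated graded ring is the image of the ring of polynomials whose
  coefficient of degree \<open>n\<close> lies in \<open>I\<^sup>n\<close>.\<close>

lemma Gr_cring:
  assumes I: "ideal I R"
  shows "cring (Gr R I)"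
proof -
  let ?J = "\<lambda>n. ideal_pow R I n"
  note pow_ideal = ideal_pow_ideal[OF I] and pow_0 = ideal_pow_0
    and pow_mult = ideal_pow_mult[OF I] and coset_mult = rcoset_mult_Gr_comp[OF I]
    and cring_R = cring_axioms
  define P where "P = UP R"
  interpret UP_cring R P
    by (rule UP_cring.intro[OF cring_R], rule eq_reflection, rule P_def)
  interpret J: ideal "?J n" R for n by (rule pow_ideal)
  define H where "H = {p \<in> carrier P. \<forall>n. coeff P p n \<in> ?J n}"
  have "subring H P"
  proof (rule P.subringI)
    show "H \<subseteq> carrier P" by (auto simp: H_def)
    show "\<one>\<^bsub>P\<^esub> \<in> H" by (auto simp: H_def pow_0)
    show "\<ominus>\<^bsub>P\<^esub> p \<in> H" if "p \<in> H" for p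
      using that by (auto simp: H_def)
    show "p \<oplus>\<^bsub>P\<^esub> q \<in> H" if "p \<in> H" "q \<in> H" for p q
      using that by (auto simp: H_def)
    show "p \<otimes>\<^bsub>P\<^esub> q \<in> H" if "p \<in> H" "q \<in> H" for p q
    proof -
      have prods: "coeff P p i \<otimes> coeff P q (n - i) \<in> ?J n" if "i \<le> n" for i n
        using pow_mult[of "coeff P p i" i "coeff P q (n - i)" "n - i"]
          that \<open>p \<in> H\<close> \<open>q \<in> H\<close> by (auto simp: H_def)
      have sums: "(\<Oplus>i \<in> A. f i) \<in> ?J n" if "finite A" "\<And>i. i \<in> A \<Longrightarrow> f i \<in> ?J n"
        for A :: "nat set" and f n
        using that
      proof (induction A)
        case (insert a A)
        then have "f \<in> A \<rightarrow> carrier R" "f a \<in> carrier R"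
          by (blast intro: J.Icarr)+
        with insert show ?case by (simp add: finsum_insert)
      qed simp
      have "(\<Oplus>i \<in> {..n}. coeff P p i \<otimes> coeff P q (n - i)) \<in> ?J n" for n
        by (rule sums) (auto intro: prods)
      with that show ?thesis by (simp add: H_def)
    qed
  qed
  then interpret H: ring "P\<lparr>carrier := H\<rparr>" by (rule P.subring_is_ring)
  define h where "h = (\<lambda>p n. ?J (Suc n) +> coeff P p n)"
  have hom: "h \<in> ring_hom (P\<lparr>carrier := H\<rparr>) (Gr R I)"
  proof (rule ring_hom_memI)
    fix p assume "p \<in> carrier (P\<lparr>carrier := H\<rparr>)"
    then have p: "p \<in> carrier P" "\<And>n. coeff P p n \<in> ?J n" by (auto simp: H_def)
    have "{n. h p n \<noteq> ?J (Suc n)} \<subseteq> {..deg R p}"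
    proof -
      have "h p n = ?J (Suc n)" if "deg R p < n" for n
        using deg_aboveD[OF that p(1)] by (simp add: h_def J.a_subset)
      then show ?thesis by force
    qed
    then show "h p \<in> carrier (Gr R I)"
      using p by (auto simp: Gr_def Gr_comp_def h_def intro: finite_subset)
    fix q assume "q \<in> carrier (P\<lparr>carrier := H\<rparr>)"
    then have q: "q \<in> carrier P" "\<And>n. coeff P q n \<in> ?J n" by (auto simp: H_def)
    show "h (p \<oplus>\<^bsub>P\<lparr>carrier := H\<rparr>\<^esub> q) = h p \<oplus>\<^bsub>Gr R I\<^esub> h q"
      using p q by (auto simp: Gr_def h_def J.a_rcos_sum)
    show "h (p \<otimes>\<^bsub>P\<lparr>carrier := H\<rparr>\<^esub> q) = h p \<otimes>\<^bsub>Gr R I\<^esub> h q"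
    proof
      fix n
      interpret Q: ring_hom_cring R "R Quot ?J (Suc n)" "(+>) (?J (Suc n))"
        by (rule J.rcos_ring_hom_cring) (rule cring_R)
      have c: "(\<lambda>i. coeff P p i \<otimes> coeff P q (n - i)) \<in> {..n} \<rightarrow> carrier R"
        using p q by auto
      have "h (p \<otimes>\<^bsub>P\<^esub> q) n =
              (\<Oplus>\<^bsub>R Quot ?J (Suc n)\<^esub> i \<in> {..n}. ?J (Suc n) +> (coeff P p i \<otimes> coeff P q (n - i)))"
        using p q by (simp add: h_def Q.hom_finsum[OF c] comp_def del: Q.hom_mult)
      also have "\<dots> = (\<Oplus>\<^bsub>R Quot ?J (Suc n)\<^esub> i \<in> {..n}.
              rcoset_mult R (?J (Suc n)) (h p i) (h q (n - i)))"
      proof -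
        have eq: "rcoset_mult R (?J (Suc n)) (h p i) (h q (n - i)) =
            ?J (Suc n) +> (coeff P p i \<otimes> coeff P q (n - i))" if "i \<le> n" for i
          using coset_mult[OF p(2)[of i] q(2)[of "n - i"]] that by (simp add: h_def)
        have "(\<lambda>i. ?J (Suc n) +> (coeff P p i \<otimes> coeff P q (n - i)))
            \<in> {..n} \<rightarrow> carrier (R Quot ?J (Suc n))"
          using c by (intro Pi_I Q.hom_closed) blast
        then show ?thesis
          by (intro Q.S.finsum_cong') (auto simp: eq)
      qed
      finally show "h (p \<otimes>\<^bsub>P\<lparr>carrier := H\<rparr>\<^esub> q) n = (h p \<otimes>\<^bsub>Gr R I\<^esub> h q) n"
        by (simp add: Gr_def)
    qed
  next
    show "h \<one>\<^bsub>P\<lparr>carrier := H\<rparr>\<^esub> = \<one>\<^bsub>Gr R I\<^esub>"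
      by (auto simp: Gr_def Gr_in_def h_def J.a_subset fun_eq_iff)
  qed
  have surj: "h ` H = carrier (Gr R I)"
  proof
    show "h ` H \<subseteq> carrier (Gr R I)"
      using hom by (auto simp: ring_hom_def)
    show "carrier (Gr R I) \<subseteq> h ` H"
    proof
      fix f assume f: "f \<in> carrier (Gr R I)"
      have "\<exists>x. x \<in> ?J n \<and> f n = ?J (Suc n) +> x \<and> (f n = ?J (Suc n) \<longrightarrow> x = \<zero>)" for n
      proof (cases "f n = ?J (Suc n)")
        case True then show ?thesis by (auto intro!: exI[of _ \<zero>] simp: J.a_subset)
      next
        case False then show ?thesis using f by (auto simp: Gr_def Gr_comp_def)
      qed
      then obtain p where p: "\<And>n. p n \<in> ?J n" "\<And>n. f n = ?J (Suc n) +> p n"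
        "\<And>n. f n = ?J (Suc n) \<Longrightarrow> p n = \<zero>" by metis
      from f have "finite {n. f n \<noteq> ?J (Suc n)}" by (simp add: Gr_def)
      then obtain N where "\<And>n. f n \<noteq> ?J (Suc n) \<Longrightarrow> n \<le> N"
        by (auto simp: finite_nat_set_iff_bounded_le)
      with p(3) have "bound \<zero> N p" by (force simp: bound_def)
      with p(1) have "p \<in> up R" by (auto intro!: mem_upI intro: J.Icarr)
      with p have "p \<in> H" "h p = f" by (auto simp: H_def h_def P_def UP_def)
      then show "f \<in> h ` H" by blast
    qed
  qed
  have zero: "h \<zero>\<^bsub>P\<^esub> = \<zero>\<^bsub>Gr R I\<^esub>"
    by (auto simp: Gr_def h_def J.a_subset)
  have "ring (Gr R I\<lparr>carrier := carrier (Gr R I), zero := \<zero>\<^bsub>Gr R I\<^esub>\<rparr>)"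
    using H.ring_hom_imp_img_ring[OF hom] by (simp add: surj zero)
  then interpret G: ring "Gr R I" by simp
  show ?thesis
  proof (unfold_locales)
    fix f g assume "f \<in> carrier (Gr R I)" "g \<in> carrier (Gr R I)"
    then obtain p q where pq: "p \<in> H" "q \<in> H" "f = h p" "g = h q"
      unfolding surj[symmetric] by blast
    then have "p \<otimes>\<^bsub>P\<^esub> q = q \<otimes>\<^bsub>P\<^esub> p" by (auto simp: H_def intro: P.m_comm)
    with pq show "f \<otimes>\<^bsub>Gr R I\<^esub> g = g \<otimes>\<^bsub>Gr R I\<^esub> f"
      using ring_hom_mult[OF hom, of p q] ring_hom_mult[OF hom, of q p] by simp
  qed
qed

end

unbundle cardinal_syntax

end

theory Submission
  imports Defs "HOL-Algebra.Ring_Divisibility"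
begin

text \<open>
  Both kinds of excluded set come from ideals of \<open>A\<close> that do not contain \<open>\<aa>\<close>. For an ideal \<open>\<cc>\<close>
  of the associated graded ring, the elements of \<open>\<aa>\<close> whose class in degree one lies in \<open>\<cc>\<close> form
  an ideal of \<open>A\<close> (\<open>Gr_degree_one_preimage_ideal\<close>). If it were all of \<open>\<aa>\<close>, then \<open>\<cc>\<close> would
  contain the whole component of degree one, and this component generates the irrelevant ideal
  (\<open>Gr_irrelevant_generated_in_degree_one\<close>). The ideal \<open>\<mm>\<aa>\<close> does not contain \<open>\<aa>\<close> either, by
  Nakayama's lemma (\<open>nakayama_ideal\<close>). As the residue field is infinite, adjoining this one
  ideal to the given families keeps their number below its cardinality.

  It remains to find an element of \<open>\<aa>\<close> outside fewer than \<open>|A / \<mm>|\<close> ideals \<open>N\<close>, none of which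
  contains \<open>\<aa>\<close> (\<open>exists_outside_few_ideals\<close>). This is the argument that a vector space is not a
  union of fewer proper subspaces than there are scalars: along a line \<open>y + r f\<close> that is not
  contained in \<open>N\<close>, two values of \<open>r\<close> for which the point lies in \<open>N\<close> differ by a nonunit. So
  every \<open>N\<close> excludes at most one residue class of \<open>r\<close>, and some residue class survives.
  Induction on the number of generators \<open>f\<close> supplies the base point \<open>y\<close>. Working with ideals of
  \<open>A\<close> rather than with subspaces of \<open>\<aa> / \<mm>\<aa>\<close> confines Nakayama's lemma to the single ideal \<open>\<mm>\<aa>\<close>.
\<close>

section \<open>Units of local rings\<close>

text \<open>Krull's theorem.  It turns the uniqueness of the maximal ideal, by which local rings are
  defined, into the invertibility of all elements outside that ideal.\<close>

lemma (in cring) proper_ideal_imp_maximalideal: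
  assumes "ideal I R" "\<one> \<notin> I"
  obtains J where "maximalideal J R" "I \<subseteq> J"
proof -
  let ?P = "{J. ideal J R \<and> I \<subseteq> J \<and> \<one> \<notin> J}"
  have "\<exists>J\<in>?P. \<forall>X\<in>?P. J \<subseteq> X \<longrightarrow> X = J"
  proof (rule subset_Zorn_nonempty)
    show "?P \<noteq> {}" using assms by blast
    fix C assume "C \<noteq> {}" and C: "subset.chain ?P C"
    then have "subset.chain {J. ideal J R} C" by (auto simp: subset.chain_def)
    from chain_Union_is_ideal[OF this] \<open>C \<noteq> {}\<close> have "ideal (\<Union>C) R" by simp
    then show "\<Union>C \<in> ?P" using C \<open>C \<noteq> {}\<close> by (auto simp: subset.chain_def)
  qed
  then obtain J where J: "ideal J R" "I \<subseteq> J" "\<one> \<notin> J"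
    and max: "\<And>X. ideal X R \<Longrightarrow> \<one> \<notin> X \<Longrightarrow> J \<subseteq> X \<Longrightarrow> X = J"
    by (smt (verit) mem_Collect_eq subset_trans)
  have "maximalideal J R"
  proof (rule maximalidealI[OF J(1)])
    show "carrier R \<noteq> J" using J(3) by blast
    show "X = J \<or> X = carrier R" if "ideal X R" "J \<subseteq> X" "X \<subseteq> carrier R" for X
      using max[OF that(1) _ that(2)] ideal.one_imp_carrier[OF that(1)] by blast
  qed
  with J(2) that show thesis by blast
qed

lemma (in ring) unit_multiple_in_ideal:
  assumes "ideal I R" "u \<in> Units R" "x \<in> carrier R" "u \<otimes> x \<in> I"
  shows "x \<in> I"
proof -
  have "inv u \<otimes> (u \<otimes> x) \<in> I" using assms by (simp add: ideal.I_l_closed)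
  moreover have "inv u \<otimes> (u \<otimes> x) = x"
    using assms(2,3) by (metis Units_closed Units_inv_closed Units_l_inv l_one m_assoc)
  ultimately show ?thesis by simp
qed

context local_ring
begin

lemma not_in_maximalideal_imp_unit:
  assumes "u \<in> carrier R" "u \<notin> M"
  shows "u \<in> Units R"
proof (rule ccontr)
  assume "u \<notin> Units R"
  have "\<one> \<notin> PIdl u"
    using \<open>u \<notin> Units R\<close> assms(1) m_comm by (force simp: cgenideal_def Units_def)
  then obtain J where "maximalideal J R" "PIdl u \<subseteq> J"
    using proper_ideal_imp_maximalideal[OF cgenideal_ideal[OF assms(1)]] by blast
  then show False using unique_maximalideal cgenideal_self[OF assms(1)] assms(2) by blast
qed

lemma one_minus_maximalideal_unit:
  assumes "u \<in> M"
  shows "\<one> \<ominus> u \<in> Units R"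
proof (rule not_in_maximalideal_imp_unit)
  have u: "u \<in> carrier R" using assms by auto
  then show "\<one> \<ominus> u \<in> carrier R" by simp
  show "\<one> \<ominus> u \<notin> M"
  proof
    assume "\<one> \<ominus> u \<in> M"
    then have "(\<one> \<ominus> u) \<oplus> u \<in> M" using assms by (rule a_closed)
    moreover have "(\<one> \<ominus> u) \<oplus> u = \<one>" using u by algebra
    ultimately show False using one_imp_carrier I_notcarr by simp
  qed
qed

end

section \<open>Nakayama's lemma for ideals\<close>

lemma (in cring) genideal_insertE:
  assumes "f \<in> carrier R" "F \<subseteq> carrier R" "x \<in> Idl (insert f F)"
  obtains r z where "r \<in> carrier R" "z \<in> Idl F" "x = r \<otimes> f \<oplus> z"
proof -
  have F: "ideal (Idl F) R" using assms(2) by (rule genideal_ideal)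
  interpret F: ideal "Idl F" R by (rule F)
  interpret P: ideal "PIdl f" R by (rule cgenideal_ideal[OF assms(1)])
  have "insert f F \<subseteq> PIdl f <+> Idl F"
  proof -
    have "f = f \<oplus> \<zero>" "\<And>g. g \<in> F \<Longrightarrow> g = \<zero> \<oplus> g" using assms(1,2) by auto
    then show ?thesis
      using cgenideal_self[OF assms(1)] genideal_self[OF assms(2)]
        F.zero_closed P.zero_closed unfolding set_add_def' by blast
  qed
  then have "Idl (insert f F) \<subseteq> PIdl f <+> Idl F"
    by (intro genideal_minimal add_ideals cgenideal_ideal assms(1) F)
  with assms(3) have "x \<in> PIdl f <+> Idl F" by blast
  then obtain p z where "p \<in> PIdl f" "z \<in> Idl F" "x = p \<oplus> z"
    unfolding set_add_def' by blast
  moreover from this(1) obtain r where "r \<in> carrier R" "p = r \<otimes> f"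
    unfolding cgenideal_def by blast
  ultimately show thesis using that by blast
qed

context local_ring
begin

text \<open>Every element of \<open>M (f, F)\<close> has the form \<open>u f + z\<close> with \<open>u\<close> in \<open>M\<close> and \<open>z\<close> in the ideal
  generated by \<open>F\<close>.  For \<open>f\<close> itself this reads \<open>(1 - u) f = z\<close>, where \<open>1 - u\<close> is invertible.\<close>

lemma redundant_generator:
  assumes f: "f \<in> carrier R" and F: "F \<subseteq> carrier R"
    and fM: "f \<in> ideal_prod R M (Idl (insert f F))"
  shows "f \<in> Idl F"
proof -
  interpret F: ideal "Idl F" R using F by (rule genideal_ideal)
  have "\<exists>u\<in>M. \<exists>z\<in>Idl F. x = u \<otimes> f \<oplus> z" if "x \<in> ideal_prod R M (Idl (insert f F))" for x
    using that
  proof induction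
    case (prod i j)
    obtain r z where rz: "r \<in> carrier R" "z \<in> Idl F" "j = r \<otimes> f \<oplus> z"
      using genideal_insertE[OF f F prod(2)] .
    have "i \<otimes> j = (i \<otimes> r) \<otimes> f \<oplus> i \<otimes> z"
      using rz prod(1) f by (simp add: r_distr m_assoc)
    moreover have "i \<otimes> r \<in> M" "i \<otimes> z \<in> Idl F"
      using rz prod(1) by (auto intro: I_r_closed F.I_l_closed)
    ultimately show ?case by blast
  next
    case (sum x y)
    then obtain u v z w where uv: "u \<in> M" "v \<in> M" and zw: "z \<in> Idl F" "w \<in> Idl F"
      and eq: "x = u \<otimes> f \<oplus> z" "y = v \<otimes> f \<oplus> w" by blast
    have "u \<in> carrier R" "v \<in> carrier R" "z \<in> carrier R" "w \<in> carrier R"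
      using uv zw by auto
    then have "x \<oplus> y = (u \<oplus> v) \<otimes> f \<oplus> (z \<oplus> w)"
      unfolding eq using f by algebra
    then show ?case using uv zw by blast
  qed
  from this[OF fM] obtain u z where u: "u \<in> M" and z: "z \<in> Idl F" and eq: "f = u \<otimes> f \<oplus> z"
    by blast
  have uc: "u \<in> carrier R" and zc: "z \<in> carrier R" using u z by auto
  have "(\<one> \<ominus> u) \<otimes> f = f \<ominus> u \<otimes> f" using uc f by algebra
  also have "\<dots> = (u \<otimes> f \<oplus> z) \<ominus> u \<otimes> f" using eq by simp
  also have "\<dots> = z" using uc f zc by algebra
  finally show ?thesis
    using unit_multiple_in_ideal[OF F.is_ideal one_minus_maximalideal_unit[OF u] f] z by simp
qed

text \<open>Under the hypothesis every generator is redundant, so that all of them can be dropped, one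
  after the other.\<close>

theorem nakayama_ideal:
  assumes "ideal I R" "finitely_generated_ideal R I" "I \<subseteq> ideal_prod R M I"
  shows "I = {\<zero>}"
proof -
  have *: "I = {\<zero>}" if "finite F" "F \<subseteq> I" "I \<subseteq> Idl F" for F
    using that
  proof (induction F)
    case empty
    then show ?case
      using genideal_minimal[OF zeroideal, of "{}"]
        additive_subgroup.zero_closed[OF ideal.axioms(1)[OF assms(1)]] by auto
  next
    case (insert f F)
    have c: "f \<in> carrier R" "F \<subseteq> carrier R" and f: "f \<in> I"
      using insert.prems(1) ideal.Icarr[OF assms(1)] by auto
    have I: "I = Idl (insert f F)"
      using insert.prems genideal_minimal[OF assms(1)] by blast
    have "f \<in> Idl F"
      using f assms(3) by (intro redundant_generator[OF c]) (auto simp flip: I)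
    then have "Idl (insert f F) \<subseteq> Idl F"
      using genideal_self[OF c(2)] by (intro genideal_minimal genideal_ideal c) auto
    then have "I \<subseteq> Idl F" using I by (rule ord_eq_le_trans[rotated])
    with insert.IH insert.prems(1) show ?case by blast
  qed
  from assms(2) obtain F where "finite F" "F \<subseteq> carrier R" "I = Idl F"
    unfolding finitely_generated_ideal_def by blast
  with * genideal_self show ?thesis by blast
qed

section \<open>Avoiding few ideals\<close>

text \<open>In the induction step the induction hypothesis gives a point \<open>y\<close> outside those \<open>N\<close> that do
  not contain \<open>F\<close>.  An \<open>N\<close> that contains \<open>F\<close> may contain \<open>y\<close>, but it does not contain the new
  generator \<open>f\<close>.  In neither case does \<open>N\<close> contain both \<open>y\<close> and \<open>f\<close>, which is why the line
  through \<open>y\<close> in the direction \<open>f\<close> meets \<open>N\<close> in at most one residue class of the parameter.\<close>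

theorem exists_outside_few_ideals:
  assumes "finite F" "F \<subseteq> carrier R"
    and "\<And>N. N \<in> \<N> \<Longrightarrow> ideal N R \<and> \<not> F \<subseteq> N"
    and "|\<N>| <o |carrier (R Quot M)|"
  shows "\<exists>x\<in>Idl F. x \<notin> \<Union>\<N>"
  using assms
proof (induction F arbitrary: \<N>)
  case empty
  then have "\<N> = {}" by blast
  moreover have "\<zero> \<in> Idl {}"
    by (intro additive_subgroup.zero_closed ideal.axioms(1) genideal_ideal) simp
  ultimately show ?case by blast
next
  case (insert f F)
  have f: "f \<in> carrier R" and F: "F \<subseteq> carrier R" using insert.prems(1) by auto
  interpret I: ideal "Idl (insert f F)" R using insert.prems(1) by (rule genideal_ideal)
  have fI: "f \<in> Idl (insert f F)" and FI: "Idl F \<subseteq> Idl (insert f F)"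
    using genideal_self[OF insert.prems(1)] subset_Idl_subset[OF insert.prems(1)] by blast+
  have "|{N \<in> \<N>. \<not> F \<subseteq> N}| \<le>o |\<N>|" by (rule card_of_mono1) blast
  then have "|{N \<in> \<N>. \<not> F \<subseteq> N}| <o |carrier (R Quot M)|"
    using insert.prems(3) by (rule ordLeq_ordLess_trans)
  then have "\<exists>y\<in>Idl F. y \<notin> \<Union>{N \<in> \<N>. \<not> F \<subseteq> N}"
    using insert.prems(2) by (intro insert.IH[OF F]) auto
  then obtain y where
    y: "y \<in> Idl F" "\<And>N. N \<in> \<N> \<Longrightarrow> \<not> F \<subseteq> N \<Longrightarrow> y \<notin> N"
    by auto
  have yc: "y \<in> carrier R" using y(1) FI I.Icarr by blast
  have same_class: "M +> r = M +> s"
    if N: "N \<in> \<N>" and rs: "r \<in> carrier R" "s \<in> carrier R"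
      and r: "y \<oplus> r \<otimes> f \<in> N" and s: "y \<oplus> s \<otimes> f \<in> N" for N r s
  proof -
    interpret N: ideal N R using insert.prems(2) N by blast
    have "r \<ominus> s \<in> M"
    proof (rule ccontr)
      assume "r \<ominus> s \<notin> M"
      then have unit: "r \<ominus> s \<in> Units R"
        using not_in_maximalideal_imp_unit rs by simp
      have "(r \<ominus> s) \<otimes> f = (y \<oplus> r \<otimes> f) \<oplus> \<ominus> (y \<oplus> s \<otimes> f)"
        using rs f yc by algebra
      also have "\<dots> \<in> N" using r s by simp
      finally have fN: "f \<in> N" using unit_multiple_in_ideal[OF N.is_ideal unit f] by simp
      have "y = (y \<oplus> r \<otimes> f) \<oplus> \<ominus> (r \<otimes> f)" using rs f yc by algebra
      also have "\<dots> \<in> N" using r fN rs N.I_l_closed by simp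
      finally have "y \<in> N" .
      moreover have "\<not> F \<subseteq> N" using fN insert.prems(2)[OF N] by blast
      ultimately show False using y(2)[OF N] by blast
    qed
    then show ?thesis using quotient_eq_iff_same_a_r_cos[OF is_ideal rs] by blast
  qed
  \<comment> \<open>The class excluded by \<open>N\<close>.  If the line misses \<open>N\<close>, then \<open>g N\<close> is an arbitrary class.\<close>
  define g where "g N = M +> (SOME r. r \<in> carrier R \<and> y \<oplus> r \<otimes> f \<in> N)" for N
  have "|g ` \<N>| <o |carrier (R Quot M)|"
    by (rule ordLeq_ordLess_trans[OF card_of_image insert.prems(3)])
  then have "\<not> carrier (R Quot M) \<subseteq> g ` \<N>"
    by (metis not_ordLess_ordLeq card_of_mono1)
  then obtain r where r: "r \<in> carrier R" "M +> r \<notin> g ` \<N>"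
    by (auto simp: FactRing_def A_RCOSETS_def')
  have "y \<oplus> r \<otimes> f \<notin> N" if N: "N \<in> \<N>" for N
  proof
    assume *: "y \<oplus> r \<otimes> f \<in> N"
    let ?Q = "\<lambda>s. s \<in> carrier R \<and> y \<oplus> s \<otimes> f \<in> N"
    have "?Q (SOME s. ?Q s)" using r(1) * by (intro someI[of ?Q r]) simp
    then have "M +> r = g N" unfolding g_def using same_class[OF N r(1) _ *] by blast
    with r(2) N show False by blast
  qed
  moreover have "y \<oplus> r \<otimes> f \<in> Idl (insert f F)"
    using y(1) FI fI r(1) I.I_l_closed by blast
  ultimately show ?case by blast
qed

end

section \<open>Homogeneous elements of the associated graded ring\<close>

definition Gr_class :: "('a, 'b) ring_scheme \<Rightarrow> 'a set \<Rightarrow> nat \<Rightarrow> 'a \<Rightarrow> (nat \<Rightarrow> 'a set)" where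
  "Gr_class R I n x = Gr_in R I n (ideal_pow R I (Suc n) +>\<^bsub>R\<^esub> x)"

context cring
begin

lemma zero_in_ideal_pow: "ideal I R \<Longrightarrow> \<zero> \<in> ideal_pow R I n"
  by (intro additive_subgroup.zero_closed ideal.axioms(1) ideal_pow_ideal)

lemma ideal_pow_carrier: "ideal I R \<Longrightarrow> x \<in> ideal_pow R I n \<Longrightarrow> x \<in> carrier R"
  by (rule ideal.Icarr[OF ideal_pow_ideal])

lemma Gr_class_component:
  assumes "ideal I R"
  shows "Gr_class R I n x k = ideal_pow R I (Suc k) +> (if k = n then x else \<zero>)"
  using additive_subgroup.a_subset[OF ideal.axioms(1)[OF ideal_pow_ideal[OF assms]]]
  by (simp add: Gr_class_def Gr_in_def)

lemma Gr_class_closed: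
  assumes I: "ideal I R" and x: "x \<in> ideal_pow R I n"
  shows "Gr_class R I n x \<in> carrier (Gr R I)"
proof -
  have "Gr_class R I n x k \<in> Gr_comp R I k" for k
    unfolding Gr_class_component[OF I] Gr_comp_def using x zero_in_ideal_pow[OF I] by auto
  moreover have "{k. Gr_class R I n x k \<noteq> ideal_pow R I (Suc k)} \<subseteq> {n}"
    by (auto simp: Gr_class_def Gr_in_def)
  ultimately show ?thesis by (auto simp: Gr_def intro: finite_subset)
qed

lemma Gr_class_zero:
  assumes "ideal I R"
  shows "Gr_class R I n \<zero> = \<zero>\<^bsub>Gr R I\<^esub>"
  using additive_subgroup.a_subset[OF ideal.axioms(1)[OF ideal_pow_ideal[OF assms]]]
  by (auto simp: Gr_class_component[OF assms] Gr_def)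

lemma Gr_class_add:
  assumes I: "ideal I R" and "x \<in> carrier R" "y \<in> carrier R"
  shows "Gr_class R I n x \<oplus>\<^bsub>Gr R I\<^esub> Gr_class R I n y = Gr_class R I n (x \<oplus> y)"
proof
  fix k
  interpret J: ideal "ideal_pow R I (Suc k)" R by (rule ideal_pow_ideal[OF I])
  show "(Gr_class R I n x \<oplus>\<^bsub>Gr R I\<^esub> Gr_class R I n y) k = Gr_class R I n (x \<oplus> y) k"
    using assms J.a_rcos_sum[of "if k = n then x else \<zero>" "if k = n then y else \<zero>"]
    by (simp add: Gr_class_component[OF I] Gr_def)
qed

text \<open>The product in the associated graded ring is a convolution.  The representatives chosen
  below vanish outside the degrees \<open>i\<close> and \<open>j\<close>, so that at most one summand survives, and the sum
  can be computed in \<open>R\<close> before passing to the quotient.\<close>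

lemma Gr_class_mult:
  assumes I: "ideal I R" and x: "x \<in> ideal_pow R I i" and y: "y \<in> ideal_pow R I j"
  shows "Gr_class R I i x \<otimes>\<^bsub>Gr R I\<^esub> Gr_class R I j y = Gr_class R I (i + j) (x \<otimes> y)"
proof
  fix n
  interpret J: ideal "ideal_pow R I (Suc n)" R by (rule ideal_pow_ideal[OF I])
  interpret Q: ring_hom_cring R "R Quot ideal_pow R I (Suc n)" "(+>) (ideal_pow R I (Suc n))"
    by (rule J.rcos_ring_hom_cring) (rule cring_axioms)
  have xy: "x \<in> carrier R" "y \<in> carrier R"
    using ideal_pow_carrier[OF I] x y by auto
  let ?p = "\<lambda>k. if k = i then x else \<zero>" and ?q = "\<lambda>k. if k = j then y else \<zero>"
  have pq: "rcoset_mult R (ideal_pow R I (Suc n)) (Gr_class R I i x k) (Gr_class R I j y (n - k))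
      = ideal_pow R I (Suc n) +> (?p k \<otimes> ?q (n - k))" if "k \<le> n" for k
    using rcoset_mult_Gr_comp[OF I, of "?p k" k "?q (n - k)" "n - k"] that x y
      zero_in_ideal_pow[OF I]
    by (simp add: Gr_class_component[OF I])
  have c: "(\<lambda>k. ?p k \<otimes> ?q (n - k)) \<in> {..n} \<rightarrow> carrier R" using xy by auto
  have "(Gr_class R I i x \<otimes>\<^bsub>Gr R I\<^esub> Gr_class R I j y) n =
      (\<Oplus>\<^bsub>R Quot ideal_pow R I (Suc n)\<^esub> k \<in> {..n}. ideal_pow R I (Suc n) +> (?p k \<otimes> ?q (n - k)))"
  proof -
    have "(\<lambda>k. ideal_pow R I (Suc n) +> (?p k \<otimes> ?q (n - k)))
        \<in> {..n} \<rightarrow> carrier (R Quot ideal_pow R I (Suc n))"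
      using c by (intro Pi_I Q.hom_closed) blast
    then show ?thesis
      by (simp only: Gr_def ring.simps monoid.simps, intro Q.S.finsum_cong')
        (auto simp only: pq atMost_iff)
  qed
  also have "\<dots> = ideal_pow R I (Suc n) +> (\<Oplus>k \<in> {..n}. ?p k \<otimes> ?q (n - k))"
    using Q.hom_finsum[OF c] by (simp only: comp_def)
  also have "(\<Oplus>k \<in> {..n}. ?p k \<otimes> ?q (n - k)) = (if n = i + j then x \<otimes> y else \<zero>)"
  proof (cases "n = i + j")
    case True
    have "(\<Oplus>k \<in> {..n}. ?p k \<otimes> ?q (n - k)) = (\<Oplus>k \<in> {..n}. if i = k then x \<otimes> y else \<zero>)"
      using True xy by (intro finsum_cong') auto
    also have "\<dots> = x \<otimes> y"
      using True xy by (subst finsum_singleton) auto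
    finally show ?thesis using True by simp
  next
    case False
    have "(\<Oplus>k \<in> {..n}. ?p k \<otimes> ?q (n - k)) = (\<Oplus>k \<in> {..n}. \<zero>)"
      using False xy by (intro finsum_cong') auto
    then show ?thesis using False by (simp add: finsum_zero)
  qed
  finally show "(Gr_class R I i x \<otimes>\<^bsub>Gr R I\<^esub> Gr_class R I j y) n = Gr_class R I (i + j) (x \<otimes> y) n"
    by (simp only: Gr_class_component[OF I, of "i + j"])
qed

text \<open>Closure under multiplication by \<open>r\<close> holds because \<open>r\<close> acts on the component of degree one
  as the class of \<open>r\<close> in degree zero, and \<open>C\<close> absorbs the latter.\<close>

lemma Gr_degree_one_preimage_ideal:
  assumes I: "ideal I R" and C: "ideal C (Gr R I)"
  shows "ideal {x \<in> I. Gr_class R I 1 x \<in> C} R" (is "ideal ?N R")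
proof (rule idealI)
  interpret I: ideal I R by (rule I)
  interpret C: ideal C "Gr R I" by (rule C)
  have mult: "r \<otimes> x \<in> ?N" if x: "x \<in> ?N" and r: "r \<in> carrier R" for r x
  proof -
    have r0: "r \<in> ideal_pow R I 0" and x1: "x \<in> ideal_pow R I 1"
      using x r ideal_pow_1[OF I] by (auto simp: ideal_pow_0)
    have "Gr_class R I 0 r \<otimes>\<^bsub>Gr R I\<^esub> Gr_class R I 1 x \<in> C"
      using x Gr_class_closed[OF I r0] by (intro C.I_l_closed) auto
    then show ?thesis
      using Gr_class_mult[OF I r0 x1] x r I.I_l_closed by simp
  qed
  show "ring R" by (rule ring_axioms)
  show "subgroup ?N (add_monoid R)"
  proof (rule add.subgroupI)
    show "?N \<subseteq> carrier R" by auto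
    have "\<zero> \<in> ?N" using Gr_class_zero[OF I, of 1] C.zero_closed I.zero_closed by simp
    then show "?N \<noteq> {}" by blast
    show "x \<oplus> y \<in> ?N" if "x \<in> ?N" "y \<in> ?N" for x y
    proof -
      have "Gr_class R I 1 x \<oplus>\<^bsub>Gr R I\<^esub> Gr_class R I 1 y \<in> C"
        using that by (intro additive_subgroup.a_closed[OF C.is_additive_subgroup]) auto
      moreover have "x \<in> I" "y \<in> I" using that by auto
      ultimately show ?thesis
        using Gr_class_add[OF I, of x y 1] I.Icarr by simp
    qed
    show "\<ominus> x \<in> ?N" if "x \<in> ?N" for x
    proof -
      have "x \<in> carrier R" using that by auto
      then show ?thesis using mult[OF that, of "\<ominus> \<one>"] l_minus[of \<one> x] by simp
    qed
  qed
  show "r \<otimes> x \<in> ?N" "x \<otimes> r \<in> ?N" if "x \<in> ?N" "r \<in> carrier R" for x r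
  proof -
    have "x \<in> carrier R" using that(1) by auto
    then show "r \<otimes> x \<in> ?N" "x \<otimes> r \<in> ?N"
      using mult[OF that] m_comm[of x r] that(2) by simp_all
  qed
qed

text \<open>The power \<open>I\<^sup>n\<^sup>+\<^sup>1\<close> consists of sums of products \<open>u v\<close> with \<open>u\<close> in \<open>I\<^sup>n\<close> and \<open>v\<close> in \<open>I\<close>, and
  the class of \<open>u v\<close> is a multiple of the class of \<open>v\<close> in degree one.  Hence \<open>C\<close> contains all
  homogeneous elements of positive degree.  Any other element of the irrelevant ideal is a finite
  sum of these.\<close>

lemma Gr_irrelevant_generated_in_degree_one:
  assumes I: "ideal I R" and C: "ideal C (Gr R I)"
    and deg1: "\<And>x. x \<in> I \<Longrightarrow> Gr_class R I 1 x \<in> C"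
  shows "Gr_irrelevant R I \<subseteq> C"
proof
  interpret C: ideal C "Gr R I" by (rule C)
  have homogeneous: "Gr_class R I (Suc n) x \<in> C" if "x \<in> ideal_pow R I (Suc n)" for n x
    using that unfolding ideal_pow_Suc
  proof induction
    case (prod u v)
    have "v \<in> ideal_pow R I 1" using prod(2) ideal_pow_1[OF I] by simp
    from Gr_class_mult[OF I prod(1) this]
    have "Gr_class R I (Suc n) (u \<otimes> v) = Gr_class R I n u \<otimes>\<^bsub>Gr R I\<^esub> Gr_class R I 1 v"
      by simp
    then show ?case
      using C.I_l_closed[OF deg1[OF prod(2)] Gr_class_closed[OF I prod(1)]] by simp
  next
    case (sum u v)
    then have "u \<in> carrier R" "v \<in> carrier R"
      using ideal_pow_carrier[OF I, of _ "Suc n"] by (auto simp: ideal_pow_Suc)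
    then show ?case
      using additive_subgroup.a_closed[OF C.is_additive_subgroup sum.IH]
      by (simp add: Gr_class_add[OF I])
  qed
  fix f assume "f \<in> Gr_irrelevant R I"
  then have f: "f \<in> carrier (Gr R I)" and f0: "f 0 = ideal_pow R I 1"
    by (auto simp: Gr_irrelevant_def Gr_def)
  have "g \<in> C" if "finite B" "g \<in> carrier (Gr R I)" "g 0 = ideal_pow R I 1"
    "{n. g n \<noteq> ideal_pow R I (Suc n)} \<subseteq> B" for B g
    using that
  proof (induction B arbitrary: g)
    case empty
    then have "g = \<zero>\<^bsub>Gr R I\<^esub>" by (auto simp: Gr_def)
    then show ?case by simp
  next
    case (insert b B)
    \<comment> \<open>Split off the component of degree \<open>b\<close>.\<close>
    let ?g = "g(b := ideal_pow R I (Suc b))"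
    have comp: "g n \<in> Gr_comp R I n" for n
      using insert.prems(1) by (simp add: Gr_def)
    have zero_comp: "ideal_pow R I (Suc b) \<in> Gr_comp R I b"
      using Gr_class_closed[OF I zero_in_ideal_pow[OF I, of b]]
      unfolding Gr_class_zero[OF I] by (simp add: Gr_def)
    have "finite {n. ?g n \<noteq> ideal_pow R I (Suc n)}"
      by (rule finite_subset[OF _ insert.hyps(1)]) (use insert.prems(3) in auto)
    then have "?g \<in> carrier (Gr R I)"
      using comp zero_comp by (simp add: Gr_def)
    moreover have "{n. ?g n \<noteq> ideal_pow R I (Suc n)} \<subseteq> B"
      using insert.prems(3) by auto
    moreover have "?g 0 = ideal_pow R I 1"
      using insert.prems(2) by (cases "b = 0") auto
    ultimately have gC: "?g \<in> C" by (intro insert.IH)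
    obtain x where x: "x \<in> ideal_pow R I b" "g b = ideal_pow R I (Suc b) +> x"
      using comp[of b] by (auto simp: Gr_comp_def)
    have xC: "Gr_class R I b x \<in> C"
    proof (cases b)
      case 0
      then have "Gr_class R I b x = \<zero>\<^bsub>Gr R I\<^esub>"
        using x(2) insert.prems(2) by (auto simp: Gr_class_def Gr_in_def Gr_def fun_eq_iff)
      then show ?thesis by simp
    next
      case (Suc m)
      then show ?thesis using homogeneous x(1) by simp
    qed
    have "g = Gr_class R I b x \<oplus>\<^bsub>Gr R I\<^esub> ?g"
    proof
      fix n
      interpret J: ideal "ideal_pow R I (Suc n)" R by (rule ideal_pow_ideal[OF I])
      obtain z where z: "z \<in> ideal_pow R I n" "g n = ideal_pow R I (Suc n) +> z"
        and zx: "n = b \<Longrightarrow> z = x"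
        using comp[of n] x by (cases "n = b") (auto simp: Gr_comp_def)
      have "?g n = ideal_pow R I (Suc n) +> (if n = b then \<zero> else z)"
        using z(2) J.a_subset by (cases "n = b") auto
      moreover have "Gr_class R I b x n = ideal_pow R I (Suc n) +> (if n = b then x else \<zero>)"
        by (rule Gr_class_component[OF I])
      ultimately show "g n = (Gr_class R I b x \<oplus>\<^bsub>Gr R I\<^esub> ?g) n"
        using J.a_rcos_sum[of "if n = b then x else \<zero>" "if n = b then \<zero> else z"]
          ideal_pow_carrier[OF I x(1)] ideal_pow_carrier[OF I z(1)] z(2) zx
        by (simp add: Gr_def)
    qed
    then show ?case using additive_subgroup.a_closed[OF C.is_additive_subgroup xC gC] by simp
  qed
  moreover have "finite {n. f n \<noteq> ideal_pow R I (Suc n)}"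
    using f by (simp add: Gr_def)
  ultimately show "f \<in> C" using f f0 by blast
qed

end

section \<open>Avoiding ideals of the ring and of its associated graded ring\<close>

theorem proposition3:
  fixes A :: "('a, 'b) ring_scheme" (structure)
    and \<mm> \<aa> :: "'a set"
    and S :: "'a set set"
    and T :: "(nat \<Rightarrow> 'a set) set set"
  assumes "local_ring A \<mm>"
    and "infinite (carrier (A Quot \<mm>))"
    and "ideal \<aa> A"
    and "finitely_generated_ideal A \<aa>"
    and "\<aa> \<noteq> {\<zero>}"
    and "\<And>\<bb>. \<bb> \<in> S \<Longrightarrow> ideal \<bb> A \<and> \<not> \<aa> \<subseteq> \<bb>"
    and "\<And>\<cc>. \<cc> \<in> T \<Longrightarrow> ideal \<cc> (Gr A \<aa>) \<and> \<not> Gr_irrelevant A \<aa> \<subseteq> \<cc>"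
    and "|S| +c |T| <o |carrier (A Quot \<mm>)|"
  shows "\<exists>x \<in> \<aa> - (ideal_prod A \<mm> \<aa> \<union> \<Union>S).
           Gr_in A \<aa> 1 (ideal_pow A \<aa> 2 +> x) \<in> Gr_deg A \<aa> 1 - \<Union>T"
proof -
  interpret local_ring A \<mm> by (rule assms(1))
  interpret \<aa>: ideal \<aa> A by (rule assms(3))
  define N where "N \<cc> = {x \<in> \<aa>. Gr_class A \<aa> 1 x \<in> \<cc>}" for \<cc>
  define \<N> where "\<N> = S \<union> N ` T \<union> {ideal_prod A \<mm> \<aa>}"
  from assms(4) obtain F where F: "finite F" "F \<subseteq> carrier A" "\<aa> = Idl F"
    unfolding finitely_generated_ideal_def by blast
  have proper: "ideal J A \<and> \<not> \<aa> \<subseteq> J" if "J \<in> \<N>" for J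
  proof -
    from that have "J \<in> S \<or> (\<exists>\<cc>\<in>T. J = N \<cc>) \<or> J = ideal_prod A \<mm> \<aa>"
      unfolding \<N>_def by blast
    then consider "J \<in> S" | \<cc> where "\<cc> \<in> T" "J = N \<cc>" | "J = ideal_prod A \<mm> \<aa>"
      by metis
    then show ?thesis
    proof cases
      case 1
      then show ?thesis by (rule assms(6))
    next
      case 2
      then have \<cc>: "ideal \<cc> (Gr A \<aa>)" "\<not> Gr_irrelevant A \<aa> \<subseteq> \<cc>"
        using assms(7) by auto
      have "\<not> \<aa> \<subseteq> N \<cc>"
        using Gr_irrelevant_generated_in_degree_one[OF assms(3) \<cc>(1)] \<cc>(2)
        unfolding N_def by blast
      with 2 Gr_degree_one_preimage_ideal[OF assms(3) \<cc>(1)] show ?thesis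
        unfolding N_def by simp
    next
      case 3
      then show ?thesis
        using ideal_prod_is_ideal[OF is_ideal assms(3)] nakayama_ideal[OF assms(3,4)] assms(5)
        by blast
    qed
  qed
  have "|S| <o |carrier (A Quot \<mm>)|" "|T| <o |carrier (A Quot \<mm>)|"
    using ordLeq_ordLess_trans[OF ordLeq_csum1 assms(8)]
      ordLeq_ordLess_trans[OF ordLeq_csum2 assms(8)] card_of_Card_order by blast+
  moreover from this(2) have "|N ` T| <o |carrier (A Quot \<mm>)|"
    by (rule ordLeq_ordLess_trans[OF card_of_image])
  moreover have "|{ideal_prod A \<mm> \<aa>}| <o |carrier (A Quot \<mm>)|"
    using assms(2) ordLess_ordLeq_trans
    by (metis finite.emptyI finite_insert finite_iff_ordLess_natLeq infinite_iff_natLeq_ordLeq)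
  ultimately have few: "|\<N>| <o |carrier (A Quot \<mm>)|"
    unfolding \<N>_def by (intro card_of_Un_ordLess_infinite assms(2))
  have "ideal J A \<and> \<not> F \<subseteq> J" if "J \<in> \<N>" for J
    using proper[OF that] genideal_minimal F(3) by blast
  from exists_outside_few_ideals[OF F(1,2) this few]
  obtain x where x: "x \<in> \<aa>" "x \<notin> \<Union>\<N>"
    using F(3) by blast
  have "x \<notin> ideal_prod A \<mm> \<aa>" "x \<notin> \<Union>S" "\<And>\<cc>. \<cc> \<in> T \<Longrightarrow> Gr_class A \<aa> 1 x \<notin> \<cc>"
    using x unfolding \<N>_def N_def by auto
  moreover have "Gr_in A \<aa> 1 (ideal_pow A \<aa> 2 +> x) = Gr_class A \<aa> 1 x"
    by (simp add: Gr_class_def numeral_2_eq_2)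
  moreover have "Gr_class A \<aa> 1 x \<in> Gr_deg A \<aa> 1"
    using x(1) ideal_pow_1[OF assms(3)] by (auto simp: Gr_class_def Gr_deg_def Gr_comp_def)
  ultimately show ?thesis using x(1) by (intro bexI[of _ x]) auto
qed

end
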